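(* We have $$\ker(\Phi_{\mathrm{B}})=\mathcal{A}=\mathrm{span}\{v_S:S\subseteq N,\ |S|\text{ even}\}\quad\text{and}\quad \mathcal{S}=\mathrm{span}\{v_S:S\subseteq N,\ |S|\text{ odd}\}.$$ The space $\mathcal{F}^N$ is the direct sum of the orthogonal subspaces $\mathcal{S}$ and $\mathcal{A}$. For every $S\subseteq N$, we have $g_S\in\mathcal{S}$. Finally, $\{g_S:S\subseteq N,\ |S|\text{ odd}\}$ is a basis of $\mathcal{S}$.
   Context: Let $n\geqslant 1$ and $N=\{1,\ldots,n\}$. Boolean vectors $\mathbf{x}\in\{0,1\}^n$ are identified with subsets $T\subseteq N$ via $x_i=1\iff i\in T$. $\mathcal{F}^N$ is the real vector space of all functions $f\colon\{0,1\}^n\to\mathbb{R}$ (equivalently $f\colon 2^N\to\mathbb{R}$), with inner product $\langle f,g\rangle=\frac{1}{2^n}\sum_{T\subseteq N}f(T)g(T)$; orthogonality refers to this inner product. For $S\subseteq N$ define the functions on $\{0,1\}^n$ $$v_S(\mathbf{x})=\prod_{i\in S}(2x_i-1),\qquad g_S(\mathbf{x})=2^{|S|}\Big(\prod_{i\in S}x_i-\prod_{i\in S}(1-x_i)\Big).$$ The Banzhaf influence index is $\Phi_{\mathrm{B}}(f,S)=\frac{1}{2^{n-|S|}}\sum_{T\subseteq N\setminus S}(f(T\cup S)-f(T))$; $\Phi_{\mathrm{B}}$ is regarded as the linear map $\mathcal{F}^N\to\mathbb{R}^{2^n}$, $f\mapsto(\Phi_{\mathrm{B}}(f,S):S\subseteq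 N)$. For $f\in\mathcal{F}^N$ define $f^*\in\mathcal{F}^N$ by $f^*(S)=-f(N\setminus S)$. Set $\mathcal{S}=\{f\in\mathcal{F}^N:f^*=f\}$ and $\mathcal{A}=\{f\in\mathcal{F}^N:f^*=-f\}$. *)

theory Defs
  imports "HOL-Analysis.Analysis"
begin

text \<open>
  The ground set \<open>N = {1,\<dots>,n}\<close> is the universe of a finite type \<open>'n\<close>, so \<open>n = CARD('n) \<ge> 1\<close>.
  The vector space of functions \<open>2\<^sup>N \<rightarrow> \<real>\<close> is \<open>real ^ ('n set)\<close>, with \<open>f $ T\<close> for \<open>f(T)\<close>; its
  linear structure is the pointwise one.
\<close>

type_synonym 'n set_fun = "real ^ ('n set)"

definition bvec :: "'n::finite set \<Rightarrow> real ^ 'n" where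
  "bvec T = (\<chi> i. if i \<in> T then 1 else 0)"

text \<open>The normalised inner product; the library's \<open>f \<bullet> g\<close> lacks the factor \<open>1 / 2^n\<close>.\<close>

definition ip :: "('n::finite) set_fun \<Rightarrow> 'n set_fun \<Rightarrow> real" where
  "ip f g = 1 / 2 ^ CARD('n) * (\<Sum>T\<in>UNIV. f $ T * g $ T)"

definition v_fun :: "'n::finite set \<Rightarrow> 'n set_fun" where
  "v_fun S = (\<chi> T. \<Prod>i\<in>S. (2 * bvec T $ i - 1))"

definition g_fun :: "'n::finite set \<Rightarrow> 'n set_fun" where
  "g_fun S = (\<chi> T. 2 ^ card S * ((\<Prod>i\<in>S. bvec T $ i) - (\<Prod>i\<in>S. (1 - bvec T $ i))))"

definition banzhaf_influence :: "('n::finite) set_fun \<Rightarrow> 'n set \<Rightarrow> real" where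
  "banzhaf_influence f S =
     1 / 2 ^ (CARD('n) - card S) * (\<Sum>T\<in>Pow (UNIV - S). f $ (T \<union> S) - f $ T)"

text \<open>The codomain \<open>\<real>\<close> to the power \<open>2^n\<close> has its coordinates indexed by the subsets of \<open>N\<close>.\<close>

definition Phi_B :: "('n::finite) set_fun \<Rightarrow> real ^ ('n set)" where
  "Phi_B f = (\<chi> S. banzhaf_influence f S)"

lemma linear_Phi_B: "linear Phi_B"
  by (rule linearI)
    (simp_all add: Phi_B_def banzhaf_influence_def vec_eq_iff sum.distrib [symmetric]
      sum_distrib_left diff_divide_distrib add_divide_distrib algebra_simps)

definition dual :: "('n::finite) set_fun \<Rightarrow> 'n set_fun" where
  "dual f = (\<chi> S. - (f $ (UNIV - S)))"

definition selfdual :: "('n::finite) set_fun set" where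
  "selfdual = {f. dual f = f}"

definition antiselfdual :: "('n::finite) set_fun set" where
  "antiselfdual = {f. dual f = - f}"

definition direct_sum :: "'a::real_vector set \<Rightarrow> 'a set \<Rightarrow> 'a set \<Rightarrow> bool" where
  "direct_sum W U V \<longleftrightarrow>
     subspace U \<and> subspace V \<and> (\<forall>u\<in>U. \<forall>w\<in>V. u + w \<in> W) \<and>
     (\<forall>x\<in>W. \<exists>!p. p \<in> U \<times> V \<and> x = fst p + snd p)"

definition basis_of :: "'a::real_vector set \<Rightarrow> 'a set \<Rightarrow> bool" where
  "basis_of B V \<longleftrightarrow> independent B \<and> span B = V"

end

theory Submission
  imports Defs
begin

text \<open>
  The functions \<open>v_S\<close> span the whole space, and \<open>v_S\<^sup>* = -(-1)\<^bsup>|S|\<^esup> v_S\<close>, so \<open>*\<close> is an involution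
  with eigenspaces spanned by the \<open>v_S\<close> of odd and of even degree. Expanding
  \<open>2 x_i = 1 + (2 x_i - 1)\<close> gives \<open>g_S = 2 \<Sum> v_U\<close>, summed over the \<open>U \<subseteq> S\<close> of odd cardinality;
  this is triangular, so the odd \<open>g_S\<close> span the self-dual functions, and they are as many as the
  dimension. Finally \<open>\<Phi>_B(f,S) = \<langle>f, g_S\<rangle>\<close>, so the kernel is the orthogonal complement of the
  self-dual functions.
\<close>

section \<open>Products of signs: the \<open>v_S\<close> form a basis of the whole space\<close>

lemma bvec_Compl: "bvec (UNIV - T) $ i = 1 - bvec T $ i"
  by (simp add: bvec_def)

lemma bvec_sign_mult:
  "(2 * bvec A $ i - 1) * (2 * bvec T $ i - 1) = (if i \<in> A \<longleftrightarrow> i \<in> T then 1 else - 1)"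
  by (simp add: bvec_def)

lemma prod_one_plus:
  fixes e :: "'a \<Rightarrow> 'b::comm_semiring_1"
  assumes "finite S"
  shows "(\<Prod>i\<in>S. 1 + e i) = (\<Sum>U\<in>Pow S. \<Prod>i\<in>U. e i)"
  using prod_add[OF assms, of e "\<lambda>_. 1"] by (simp add: add.commute)

text \<open>The sum over all \<open>U\<close> is the expansion of a product over the ground set,
  whose factor at \<open>i\<close> is 2 if \<open>A\<close> and \<open>T\<close> agree at
  \<open>i\<close> and 0 otherwise.\<close>

lemma sum_v_fun_mult:
  fixes A T :: "'n::finite set"
  shows "(\<Sum>U\<in>UNIV. v_fun U $ A * v_fun U $ T) = (if A = T then 2 ^ CARD('n) else 0)"
proof -
  have "(\<Sum>U\<in>UNIV. v_fun U $ A * v_fun U $ T)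
      = (\<Prod>i\<in>(UNIV::'n set). 1 + (2 * bvec A $ i - 1) * (2 * bvec T $ i - 1))"
    by (subst prod_one_plus) (simp_all add: v_fun_def prod.distrib)
  also have "\<dots> = (if A = T then 2 ^ CARD('n) else 0)"
    unfolding bvec_sign_mult by (auto simp: prod_zero_iff)
  finally show ?thesis .
qed

lemma span_v_fun: "span (range v_fun) = (UNIV :: ('n::finite) set_fun set)"
proof -
  have "f \<in> span (range v_fun)" for f :: "'n set_fun"
  proof -
    \<comment> \<open>Fourier inversion: the coefficient of \<open>v_fun U\<close> is
      \<open>ip f (v_fun U)\<close>, written out.\<close>
    have "f = (\<Sum>U\<in>UNIV. (\<Sum>A\<in>UNIV. f $ A * v_fun U $ A / 2 ^ CARD('n)) *\<^sub>R v_fun U)"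
    proof (rule vec_eq_iff[THEN iffD2], rule allI)
      fix T
      have "(\<Sum>U\<in>UNIV. (\<Sum>A\<in>UNIV. f $ A * v_fun U $ A / 2 ^ CARD('n)) *\<^sub>R v_fun U) $ T
          = (\<Sum>U\<in>UNIV. \<Sum>A\<in>UNIV. f $ A / 2 ^ CARD('n) * (v_fun U $ A * v_fun U $ T))"
        by (simp add: sum_distrib_right mult.assoc)
      also have "\<dots> = (\<Sum>A\<in>UNIV. f $ A / 2 ^ CARD('n) * (\<Sum>U\<in>UNIV. v_fun U $ A * v_fun U $ T))"
        by (subst sum.swap) (simp add: sum_distrib_left)
      also have "\<dots> = f $ T"
        unfolding sum_v_fun_mult by (simp add: if_distrib sum.delta cong: if_cong)
      finally show "f $ T
          = (\<Sum>U\<in>UNIV. (\<Sum>A\<in>UNIV. f $ A * v_fun U $ A / 2 ^ CARD('n)) *\<^sub>R v_fun U) $ T" ..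
    qed
    also have "\<dots> \<in> span (range v_fun)"
      by (intro span_sum span_scale span_base) auto
    finally show ?thesis .
  qed
  then show ?thesis by blast
qed

text \<open>A spanning family with only as many indices as the dimension has no room for repetitions
  or linear relations. It serves both the \<open>v_S\<close> and the odd \<open>g_S\<close>.\<close>

lemma card_eq_dim_imp_inj_independent:
  fixes b :: "'i \<Rightarrow> 'a::euclidean_space"
  assumes "finite I" and "span (b ` I) = V" and "dim V = card I"
  shows "inj_on b I \<and> independent (b ` I)"
proof -
  have "dim V \<le> card (b ` I)"
    using assms by (metis dim_le_card' dim_span finite_imageI)
  then have "card (b ` I) = card I"
    using assms card_image_le[of I b] by simp
  moreover have "independent (b ` I)"
    using assms calculation by (intro card_le_dim_spanning[of _ V]) (auto intro: span_base)
  ultimately show ?thesis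
    using assms(1) by (simp add: eq_card_imp_inj_on)
qed

lemma inj_independent_v_fun:
  "inj (v_fun :: 'n::finite set \<Rightarrow> 'n set_fun)"
  "independent (range (v_fun :: 'n::finite set \<Rightarrow> 'n set_fun))"
  using card_eq_dim_imp_inj_independent[OF _ span_v_fun[where ?'n = 'n]]
  by (simp_all add: dim_UNIV)

section \<open>Duality and its eigenspaces\<close>

lemma linear_dual: "linear dual"
  by (rule linearI) (simp_all add: dual_def vec_eq_iff)

lemma dual_dual [simp]: "dual (dual f) = f"
  by (simp add: dual_def vec_eq_iff double_diff)

text \<open>Complementing the argument negates each of the \<open>card S\<close> factors; the minus
  sign in \<open>dual\<close> then makes the odd degrees the fixed ones.\<close>

lemma dual_v_fun: "dual (v_fun S) = (if odd (card S) then v_fun S else - v_fun S)"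
proof -
  have "v_fun S $ (UNIV - T) = (- 1) ^ card S * v_fun S $ T" for T
  proof -
    have "v_fun S $ (UNIV - T) = (\<Prod>i\<in>S. (- 1) * (2 * bvec T $ i - 1))"
      unfolding v_fun_def by (simp add: bvec_Compl algebra_simps)
    then show ?thesis
      by (simp only: prod.distrib prod_constant) (simp add: v_fun_def)
  qed
  then show ?thesis
    by (simp add: dual_def vec_eq_iff)
qed

lemma subspace_selfdual: "subspace selfdual"
  unfolding subspace_def selfdual_def
  by (simp add: linear_0[OF linear_dual] linear_add[OF linear_dual] linear_scale[OF linear_dual])

lemma subspace_antiselfdual: "subspace antiselfdual"
  unfolding subspace_def antiselfdual_def
  by (simp add: linear_0[OF linear_dual] linear_add[OF linear_dual] linear_scale[OF linear_dual])

text \<open>Since the \<open>v_S\<close> span everything, a linear map needs to be checked on them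
  only. It is applied to \<open>f + dual f\<close> and \<open>f - dual f\<close>, twice the
  projections onto the two eigenspaces.\<close>

lemma linear_image_in_span_if_v_fun:
  fixes P :: "('n::finite) set_fun \<Rightarrow> 'b::real_vector"
  assumes "linear P" and "\<And>S. P (v_fun S) \<in> span B"
  shows "P f \<in> span B"
proof -
  have "P f \<in> P ` span (range v_fun)"
    by (simp add: span_v_fun)
  also have "\<dots> = span (P ` range v_fun)"
    by (rule linear_span_image[OF assms(1), symmetric])
  also have "\<dots> \<subseteq> span B"
    using assms(2) by (intro span_minimal subspace_span) auto
  finally show ?thesis .
qed

lemma selfdual_eq_span: "selfdual = span (v_fun ` {S. odd (card S)})" (is "_ = ?W")
proof
  show "?W \<subseteq> selfdual"
    by (rule span_minimal[OF _ subspace_selfdual]) (auto simp: selfdual_def dual_v_fun)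
  have "v_fun S + dual (v_fun S) \<in> ?W" for S
  proof -
    have "v_fun S + dual (v_fun S) = (if odd (card S) then 2 *\<^sub>R v_fun S else 0)"
      by (simp add: dual_v_fun scaleR_2)
    then show ?thesis
      by (simp add: span_zero span_scale span_base)
  qed
  then have P: "f + dual f \<in> ?W" for f
    by (rule linear_image_in_span_if_v_fun[OF linear_compose_add[OF linear_ident linear_dual]])
  show "selfdual \<subseteq> ?W"
  proof
    fix f :: "'a set_fun" assume "f \<in> selfdual"
    then have "f = (1/2) *\<^sub>R (f + dual f)"
      by (simp add: selfdual_def vec_eq_iff)
    then show "f \<in> ?W"
      by (rule ssubst[where P = "\<lambda>f. f \<in> ?W"]) (rule span_scale[OF P])
  qed
qed

lemma antiselfdual_eq_span: "antiselfdual = span (v_fun ` {S. even (card S)})" (is "_ = ?W")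
proof
  show "?W \<subseteq> antiselfdual"
    by (rule span_minimal[OF _ subspace_antiselfdual]) (auto simp: antiselfdual_def dual_v_fun)
  have "v_fun S - dual (v_fun S) \<in> ?W" for S
  proof -
    have "v_fun S - dual (v_fun S) = (if even (card S) then 2 *\<^sub>R v_fun S else 0)"
      by (simp add: dual_v_fun scaleR_2)
    then show ?thesis
      by (simp add: span_zero span_scale span_base)
  qed
  then have P: "f - dual f \<in> ?W" for f
    by (rule linear_image_in_span_if_v_fun[OF linear_compose_sub[OF linear_ident linear_dual]])
  show "antiselfdual \<subseteq> ?W"
  proof
    fix f :: "'a set_fun" assume "f \<in> antiselfdual"
    then have "f = (1/2) *\<^sub>R (f - dual f)"
      by (simp add: antiselfdual_def vec_eq_iff)
    then show "f \<in> ?W"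
      by (rule ssubst[where P = "\<lambda>f. f \<in> ?W"]) (rule span_scale[OF P])
  qed
qed

section \<open>Orthogonality and the direct sum\<close>

lemma ip_eq_inner: "ip f h = (f \<bullet> h) / 2 ^ CARD('n)"
  for f h :: "('n::finite) set_fun"
  by (simp add: ip_def inner_vec_def)

text \<open>The two minus signs cancel, and complementation only permutes the terms of the
  sum.\<close>

lemma inner_dual_dual: "dual f \<bullet> dual h = f \<bullet> h"
proof -
  have "bij (\<lambda>T. UNIV - T :: 'a set)"
    by (rule involuntory_imp_bij) (simp add: double_diff)
  then show ?thesis
    unfolding inner_vec_def dual_def
    by (simp add: sum.reindex_bij_betw[of _ UNIV UNIV "\<lambda>T. f $ T * h $ T"])
qed

lemma inner_selfdual_antiselfdual:
  assumes "f \<in> selfdual" "h \<in> antiselfdual"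
  shows "f \<bullet> h = 0"
  using inner_dual_dual[of f h] assms by (simp add: selfdual_def antiselfdual_def)

lemma selfdual_antiselfdual_decomp:
  obtains s a where "s \<in> selfdual" "a \<in> antiselfdual" "f = s + a"
proof
  let ?s = "(1/2) *\<^sub>R (f + dual f)" and ?a = "(1/2) *\<^sub>R (f - dual f)"
  show "?s \<in> selfdual" "?a \<in> antiselfdual"
    by (simp_all add: selfdual_def antiselfdual_def linear_scale[OF linear_dual]
        linear_add[OF linear_dual] linear_diff[OF linear_dual] algebra_simps)
  show "f = ?s + ?a"
    by (simp add: vec_eq_iff field_simps)
qed

lemma direct_sum_selfdual_antiselfdual: "direct_sum UNIV selfdual antiselfdual"
proof -
  have "\<exists>!p. p \<in> selfdual \<times> antiselfdual \<and> f = fst p + snd p" for f :: "'a set_fun"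
  proof (rule ex_ex1I)
    show "\<exists>p. p \<in> selfdual \<times> antiselfdual \<and> f = fst p + snd p"
      by (rule selfdual_antiselfdual_decomp[of f]) auto
  next
    fix p q :: "'a set_fun \<times> 'a set_fun"
    assume p: "p \<in> selfdual \<times> antiselfdual \<and> f = fst p + snd p"
      and q: "q \<in> selfdual \<times> antiselfdual \<and> f = fst q + snd q"
    define d where "d = fst p - fst q"
    have d: "d = snd q - snd p"
    proof -
      have "fst p + snd p = fst q + snd q" using p q by auto
      then show ?thesis by (simp add: d_def algebra_simps)
    qed
    have "d \<in> selfdual"
      unfolding d_def using p q by (intro subspace_diff[OF subspace_selfdual]) auto
    moreover have "d \<in> antiselfdual"
      unfolding d using p q by (intro subspace_diff[OF subspace_antiselfdual]) auto
    \<comment> \<open>Lying in both subspaces, \<open>d\<close> is orthogonal to itself.\<close>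
    ultimately have "d = 0"
      using inner_selfdual_antiselfdual[of d d] by simp
    with d show "p = q"
      by (simp add: d_def prod_eq_iff)
  qed
  then show ?thesis
    by (simp add: direct_sum_def subspace_selfdual subspace_antiselfdual)
qed

section \<open>The odd \<open>g_S\<close> as a basis of the self-dual functions\<close>

lemma g_fun_eq_sum: "g_fun S = 2 *\<^sub>R (\<Sum>U | U \<subseteq> S \<and> odd (card U). v_fun U)"
proof (rule vec_eq_iff[THEN iffD2], rule allI)
  fix T :: "'a set"
  let ?e = "\<lambda>i. 2 * bvec T $ i - 1"
  have scale: "2 ^ card S * (\<Prod>i\<in>S. h i) = (\<Prod>i\<in>S. 2 * h i)" for h :: "'a \<Rightarrow> real"
    by (simp add: prod.distrib)
  \<comment> \<open>Spreading \<open>2 ^ card S\<close> over the factors turns \<open>x_i\<close>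
    into \<open>1 + e_i\<close> and \<open>1 - x_i\<close> into \<open>1 - e_i\<close>, where
    \<open>e_i = 2 x_i - 1\<close>.\<close>
  have "g_fun S $ T = (\<Prod>i\<in>S. 1 + ?e i) - (\<Prod>i\<in>S. 1 + (- 1) * ?e i)"
    unfolding g_fun_def by (simp add: right_diff_distrib scale)
  also have "\<dots> = (\<Sum>U\<in>Pow S. (1 - (- 1) ^ card U) * (\<Prod>i\<in>U. ?e i))"
    unfolding prod_one_plus[OF finite] sum_subtractf[symmetric]
    by (intro sum.cong refl) (simp only: prod.distrib prod_constant left_diff_distrib mult_1)
  \<comment> \<open>The coefficient \<open>1 - (- 1) ^ card U\<close> is 2 for odd and 0 for even
    cardinality.\<close>
  also have "\<dots> = (\<Sum>U | U \<subseteq> S \<and> odd (card U). 2 * (\<Prod>i\<in>U. ?e i))"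
    by (rule sum.mono_neutral_cong_right) auto
  finally show "g_fun S $ T = (2 *\<^sub>R (\<Sum>U | U \<subseteq> S \<and> odd (card U). v_fun U)) $ T"
    by (simp add: v_fun_def sum_distrib_left)
qed

lemma g_fun_selfdual: "g_fun S \<in> selfdual"
  unfolding g_fun_eq_sum selfdual_eq_span
  by (intro span_scale span_sum span_base) auto

lemma v_fun_in_span_g_fun:
  assumes "odd (card S)"
  shows "v_fun S \<in> span (g_fun ` {S. odd (card S)})"
  using finite[of S] assms
proof (induction S rule: finite_psubset_induct)
  case (psubset S)
  let ?W = "span (g_fun ` {S. odd (card S)})"
  \<comment> \<open>As \<open>card S\<close> is odd, \<open>v_fun S\<close> itself occurs in the
    expansion of \<open>g_fun S\<close> and can be isolated; the other terms fall under the
    induction hypothesis.\<close>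
  have "{U. U \<subseteq> S \<and> odd (card U)} = insert S {U. U \<subset> S \<and> odd (card U)}"
    using psubset.prems by auto
  then have "v_fun S = (1/2) *\<^sub>R g_fun S - (\<Sum>U | U \<subset> S \<and> odd (card U). v_fun U)"
    by (simp add: g_fun_eq_sum)
  also have "\<dots> \<in> ?W"
    using psubset by (intro span_diff span_scale span_sum) (auto intro: span_base)
  finally show ?case .
qed

lemma span_g_fun: "span (g_fun ` {S. odd (card S)}) = selfdual"
proof
  show "span (g_fun ` {S. odd (card S)}) \<subseteq> selfdual"
    by (rule span_minimal[OF _ subspace_selfdual]) (auto simp: g_fun_selfdual)
  show "selfdual \<subseteq> span (g_fun ` {S. odd (card S)})"
    unfolding selfdual_eq_span
    by (rule span_minimal[OF _ subspace_span]) (auto simp: v_fun_in_span_g_fun)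
qed

lemma dim_selfdual: "dim (selfdual :: ('n::finite) set_fun set) = card {S :: 'n set. odd (card S)}"
proof -
  let ?O = "{S :: 'n set. odd (card S)}"
  have "independent (v_fun ` ?O)"
    using inj_independent_v_fun(2) by (rule independent_mono) auto
  then have "dim (selfdual :: 'n set_fun set) = card (v_fun ` ?O)"
    by (simp add: selfdual_eq_span dim_eq_card_independent)
  also have "\<dots> = card ?O"
    by (intro card_image inj_on_subset[OF inj_independent_v_fun(1)]) auto
  finally show ?thesis .
qed

section \<open>The Banzhaf influence index and its kernel\<close>

text \<open>Up to the factor \<open>2 ^ card S\<close>, \<open>g_fun S\<close> is the indicator of
  the supersets of \<open>S\<close> minus that of the sets disjoint from \<open>S\<close>; the
  factor corrects the normalisation of \<open>ip\<close>.\<close>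

lemma banzhaf_influence_eq_ip: "banzhaf_influence f S = ip f (g_fun S)"
  for f :: "('n::finite) set_fun"
proof -
  have g: "g_fun S $ T = 2 ^ card S * ((if S \<subseteq> T then 1 else 0) - (if T \<subseteq> UNIV - S then 1 else 0))"
    for T
  proof -
    have "(\<Prod>i\<in>S. bvec T $ i) = (if S \<subseteq> T then 1 else 0)"
      by (auto simp: bvec_def prod_zero_iff intro!: prod.neutral)
    moreover have "(\<Prod>i\<in>S. 1 - bvec T $ i) = (if T \<subseteq> UNIV - S then 1 else 0)"
      by (auto simp: bvec_def prod_zero_iff intro!: prod.neutral)
    ultimately show ?thesis by (simp add: g_fun_def)
  qed
  have up: "(\<Sum>T\<in>Pow (UNIV - S). f $ (T \<union> S)) = (\<Sum>T | S \<subseteq> T. f $ T)"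
    by (rule sum.reindex_bij_witness[of _ "\<lambda>T. T - S" "\<lambda>T. T \<union> S"]) auto
  have "2 ^ CARD('n) = (2::real) ^ (CARD('n) - card S) * 2 ^ card S"
    by (simp add: card_mono flip: power_add)
  then have "ip f (g_fun S) = 1 / 2 ^ (CARD('n) - card S) *
      (\<Sum>T\<in>UNIV. (if S \<subseteq> T then f $ T else 0) - (if T \<subseteq> UNIV - S then f $ T else 0))"
    unfolding ip_def g sum_distrib_left by (intro sum.cong) simp_all
  also have "(\<Sum>T\<in>UNIV. (if S \<subseteq> T then f $ T else 0) - (if T \<subseteq> UNIV - S then f $ T else 0))
      = (\<Sum>T | S \<subseteq> T. f $ T) - (\<Sum>T\<in>Pow (UNIV - S). f $ T)"
    by (simp add: sum_subtractf Pow_def flip: sum.inter_filter)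
  finally show ?thesis
    by (simp add: banzhaf_influence_def sum_subtractf up)
qed

lemma kernel_Phi_B: "{f. Phi_B f = 0} = antiselfdual"
proof -
  have "Phi_B f = 0 \<longleftrightarrow> (\<forall>S. f \<bullet> g_fun S = 0)" for f :: "'a set_fun"
    by (simp add: Phi_B_def vec_eq_iff banzhaf_influence_eq_ip ip_eq_inner)
  moreover have "(\<forall>S. f \<bullet> g_fun S = 0) \<longleftrightarrow> f \<in> antiselfdual" for f :: "'a set_fun"
  proof
    assume "f \<in> antiselfdual"
    then show "\<forall>S. f \<bullet> g_fun S = 0"
      using inner_selfdual_antiselfdual g_fun_selfdual by (metis inner_commute)
  next
    assume *: "\<forall>S. f \<bullet> g_fun S = 0"
    obtain s a where sa: "s \<in> selfdual" "a \<in> antiselfdual" "f = s + a"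
      by (rule selfdual_antiselfdual_decomp)
    \<comment> \<open>The odd \<open>g_S\<close> already span the self-dual functions, to which
      \<open>s\<close> belongs.\<close>
    have "orthogonal f s"
      using sa(1) * 
      by (intro orthogonal_to_span[of s "g_fun ` {S. odd (card S)}"])
        (auto simp: span_g_fun orthogonal_def)
    \<comment> \<open>As \<open>a\<close> is orthogonal to \<open>s\<close>, the product of
      \<open>f\<close> with \<open>s\<close> is that of \<open>s\<close> with itself.\<close>
    then have "s = 0"
      using inner_selfdual_antiselfdual[OF sa(1,2)] sa(3)
      by (simp add: orthogonal_def inner_add_left inner_add_right inner_commute)
    with sa show "f \<in> antiselfdual" by simp
  qed
  ultimately show ?thesis by blast
qed

theorem proposition4p6:
  "{f :: ('n::finite) set_fun. Phi_B f = 0} = antiselfdual \<and>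
   (antiselfdual :: 'n set_fun set) = span {v_fun S | S. even (card S)} \<and>
   (selfdual :: 'n set_fun set) = span {v_fun S | S. odd (card S)} \<and>
   direct_sum (UNIV :: 'n set_fun set) selfdual antiselfdual \<and>
   (\<forall>f \<in> (selfdual :: 'n set_fun set). \<forall>h \<in> antiselfdual. ip f h = 0) \<and>
   (\<forall>S :: 'n set. g_fun S \<in> selfdual) \<and>
   inj_on g_fun {S :: 'n set. odd (card S)} \<and>
   basis_of {g_fun S | S :: 'n set. odd (card S)} selfdual"
proof -
  have g: "inj_on g_fun {S :: 'n set. odd (card S)} \<and> independent (g_fun ` {S :: 'n set. odd (card S)})"
    by (rule card_eq_dim_imp_inj_independent[OF finite span_g_fun dim_selfdual])
  have "\<forall>f \<in> (selfdual :: 'n set_fun set). \<forall>h \<in> antiselfdual. ip f h = 0"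
    by (simp add: ip_eq_inner inner_selfdual_antiselfdual)
  with g show ?thesis
    unfolding basis_of_def setcompr_eq_image
    by (intro conjI kernel_Phi_B antiselfdual_eq_span selfdual_eq_span span_g_fun
        direct_sum_selfdual_antiselfdual allI g_fun_selfdual) simp_all
qed

end
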